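(* Let $F$ be the face $(U_{2,3}^{123},U_{1,4})$ of $\Gamma_4$. For real $a,b\ge0$, the point $\mathbf h=(a,b)\in F$ is entropic if and only if either $a\ge 0$ and $b>0$, or $(a,b)=(\log v,0)$ for some positive integer $v$.
   Context: $N_4=\{1,2,3,4\}$. $\Gamma_4$ is the cone of all polymatroid rank functions on $N_4$. A set function $\mathbf h:2^{N_4}\to\mathbb R$ is called entropic if there is a random vector $(X_1,X_2,X_3,X_4)$, each $X_i$ taking values in a finite set, with $\mathbf h(A)=H(X_A)$ for all $A\subseteq N_4$, where $H$ is Shannon entropy, $X_A=(X_j,j\in A)$ and $\mathbf h(\emptyset)=0$. Logarithms (also in the entropy) are to base $2$. For two (poly)matroids $M_1,M_2$ on $N_4$ with rank functions $\mathbf r_1,\mathbf r_2$, $(M_1,M_2)$ denotes the face $\{a\mathbf r_1+b\mathbf r_2:a,b\ge0\}$ of $\Gamma_4$, and $(a,b)$ denotes the point $a\mathbf r_1+b\mathbf r_2$. $U^{123}_{2,3}$ is the matroid on $N_4$ with rank function $\mathbf r(A)=\min\{2,|A\cap\{1,2,3\}|\}$; $U_{1,4}$ is the uniform matroid on $N_4$ with $\mathbf r(A)=\min\{1,|A|\}$. *)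

theory Defs
  imports "HOL-Probability.Probability"
begin

text \<open>
  The ground set is the numeral type \<open>4\<close>, whose elements are \<open>1, 2, 3, 4\<close> (where \<open>4 = 0\<close>
  internally), so that \<open>UNIV = {1, 2, 3, 4}\<close>.  A set function on its power set is a vector
  \<open>h :: real ^ (4 set)\<close> with values \<open>h $ A\<close>; this is a Euclidean space of dimension 16, where
  the library's cones and faces are available.
\<close>

definition polymatroid_cone :: "(real ^ (4 set)) set" where
  "polymatroid_cone = {h. h $ {} = 0 \<and>
     (\<forall>A B. A \<subseteq> B \<longrightarrow> h $ A \<le> h $ B) \<and>
     (\<forall>A B. h $ (A \<union> B) + h $ (A \<inter> B) \<le> h $ A + h $ B)}"

definition face_point :: "real ^ (4 set) \<Rightarrow> real ^ (4 set) \<Rightarrow> real \<Rightarrow> real \<Rightarrow> real ^ (4 set)" where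
  "face_point r1 r2 a b = a *\<^sub>R r1 + b *\<^sub>R r2"

definition spanned_face :: "real ^ (4 set) \<Rightarrow> real ^ (4 set) \<Rightarrow> (real ^ (4 set)) set" where
  "spanned_face r1 r2 = {face_point r1 r2 a b | a b. 0 \<le> a \<and> 0 \<le> b}"

definition U23_123 :: "real ^ (4 set)" where
  "U23_123 = (\<chi> A. real (min 2 (card (A \<inter> {1, 2, 3}))))"

definition U14 :: "real ^ (4 set)" where
  "U14 = (\<chi> A. real (min 1 (card A)))"

definition subvector :: "(4 \<Rightarrow> 'a \<Rightarrow> 'b) \<Rightarrow> 4 set \<Rightarrow> 'a \<Rightarrow> 4 \<Rightarrow> 'b" where
  "subvector X A \<omega> = (\<lambda>i\<in>A. X i \<omega>)"

definition shannon_entropy :: "'a measure \<Rightarrow> ('a \<Rightarrow> 'b) \<Rightarrow> real" where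
  "shannon_entropy M Y = prob_space.entropy M 2 (count_space (Y ` space M)) Y"

text \<open>
  Simple functions are the measurable functions with finitely many values.  HOL cannot quantify
  over the types of the sample space and of the values; fixing both to be \<open>nat\<close> loses no
  generality, see \<open>entropicI\<close> below.
\<close>

definition entropic :: "real ^ (4 set) \<Rightarrow> bool" where
  "entropic h \<longleftrightarrow> (\<exists>(M :: nat measure) (X :: 4 \<Rightarrow> nat \<Rightarrow> nat).
     prob_space M \<and> (\<forall>i. simple_function M (X i)) \<and>
     (\<forall>A. h $ A = shannon_entropy M (subvector X A)))"


lemma shannon_entropy_simple:
  assumes "prob_space M" "simple_function M Y"
  shows "shannon_entropy M Y = - (\<Sum>y\<in>Y ` space M.
    measure M (Y -` {y} \<inter> space M) * log 2 (measure M (Y -` {y} \<inter> space M)))"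
proof -
  interpret prob_space M by fact
  interpret information_space M 2 by unfold_locales simp
  show ?thesis unfolding shannon_entropy_def
    by (rule entropy_simple_distributed[OF simple_distributedI[OF assms(2) measure_nonneg refl]])
qed

lemma simple_function_subvector:
  fixes X :: "4 \<Rightarrow> 'a \<Rightarrow> 'b"
  assumes "\<And>i. simple_function M (X i)"
  shows "simple_function M (subvector X A)"
proof -
  have "simple_function M (\<lambda>\<omega>. (X 1 \<omega>, X 2 \<omega>, X 3 \<omega>, X 4 \<omega>))"
    by (intro simple_function_Pair assms)
  from simple_function_compose1[OF this,
      of "\<lambda>(p, q, r, s). (\<lambda>i\<in>A. if i = 1 then p else if i = 2 then q else if i = 3 then r else s)"]
  have "simple_function M (\<lambda>\<omega>. (\<lambda>i\<in>A. if i = 1 then X 1 \<omega> else if i = 2 then X 2 \<omega>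
      else if i = 3 then X 3 \<omega> else X 4 \<omega>))"
    by simp
  moreover have "(if i = 1 then X 1 \<omega> else if i = 2 then X 2 \<omega>
      else if i = 3 then X 3 \<omega> else X 4 \<omega>) = X i \<omega>" for i \<omega>
    using exhaust_4[of i] by auto
  ultimately show ?thesis by (simp add: subvector_def[abs_def])
qed

lemma shannon_entropy_inj:
  assumes M: "prob_space M" and N: "prob_space N"
    and Y: "simple_function M Y" and Z: "simple_function N Z"
    and g: "inj_on g (Y ` space M)" "Z ` space N = g ` Y ` space M"
    and eq: "\<And>y. y \<in> Y ` space M \<Longrightarrow>
      measure N (Z -` {g y} \<inter> space N) = measure M (Y -` {y} \<inter> space M)"
  shows "shannon_entropy N Z = shannon_entropy M Y"
  unfolding shannon_entropy_simple[OF M Y] shannon_entropy_simple[OF N Z] g(2)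
  by (simp add: sum.reindex[OF g(1)] eq)

text \<open>Finitely-valued random vectors on arbitrary probability spaces yield entropic functions.\<close>

lemma entropicI:
  fixes M :: "'a measure" and X :: "4 \<Rightarrow> 'a \<Rightarrow> 'b"
  assumes M: "prob_space M" and X: "\<And>i. simple_function M (X i)"
    and h: "\<And>A. h $ A = shannon_entropy M (subvector X A)"
  shows "entropic h"
proof -
  interpret prob_space M by fact
  define T where "T = subvector X UNIV"
  have T: "simple_function M T" unfolding T_def by (rule simple_function_subvector[OF X])
  have fin: "finite (T ` space M)" using T by (rule simple_functionD)
  define V where "V = (\<Union>i. X i ` space M)"
  have finV: "finite V" unfolding V_def using X by (auto intro: simple_functionD)
  obtain c :: "(4 \<Rightarrow> 'b) \<Rightarrow> nat" where c: "inj_on c (T ` space M)"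
    using finite_imp_inj_to_nat_seg[OF fin] by auto
  obtain e :: "'b \<Rightarrow> nat" where e: "inj_on e V"
    using finite_imp_inj_to_nat_seg[OF finV] by auto
  define f where "f = c \<circ> T"
  define S where "S = f ` space M"
  define N where "N = distr M (count_space S) f"
  define X' where "X' i n = e (inv_into (T ` space M) c n i)" for i :: 4 and n
  have X'f: "X' i (f \<omega>) = e (X i \<omega>)" if "\<omega> \<in> space M" for i \<omega>
    using that inv_into_f_f[OF c, of "T \<omega>"] by (simp add: X'_def f_def T_def subvector_def)
  have finS: "finite S" unfolding S_def f_def using fin by (metis finite_imageI image_comp)
  have sf: "simple_function M f" unfolding f_def by (rule simple_function_compose[OF T])
  have fm: "f \<in> measurable M (count_space S)"
    using sf unfolding S_def by (simp add: measurable_count_space_eq2 simple_function_def)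
  have N: "prob_space N" unfolding N_def by (rule prob_space_distr[OF fm])
  have spN: "space N = S" "sets N = Pow S" by (auto simp: N_def)
  have X': "simple_function N (X' i)" for i
    by (auto simp: simple_function_def spN finS)
  have "shannon_entropy N (subvector X' A) = shannon_entropy M (subvector X A)" for A
  proof (rule shannon_entropy_inj[OF M N simple_function_subvector[OF X]
        simple_function_subvector[OF X'], where g = "\<lambda>y. (\<lambda>i\<in>A. e (y i))"])
    let ?g = "\<lambda>y. (\<lambda>i\<in>A. e (y i))"
    have sub: "subvector X' A (f \<omega>) = ?g (subvector X A \<omega>)" if "\<omega> \<in> space M" for \<omega>
      using X'f[OF that] by (auto simp: subvector_def)
    show inj: "inj_on ?g (subvector X A ` space M)"
    proof (rule inj_onI, clarify)
      fix \<omega> \<omega>' assume w: "\<omega> \<in> space M" "\<omega>' \<in> space M"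
        and eq: "?g (subvector X A \<omega>) = ?g (subvector X A \<omega>')"
      have "X i \<omega> = X i \<omega>'" if "i \<in> A" for i
      proof -
        have "e (X i \<omega>) = e (X i \<omega>')"
          using fun_cong[OF eq, of i] that by (simp add: subvector_def)
        moreover have "X i \<omega> \<in> V" "X i \<omega>' \<in> V" using w by (auto simp: V_def)
        ultimately show ?thesis using e by (auto dest: inj_onD)
      qed
      then show "subvector X A \<omega> = subvector X A \<omega>'" by (auto simp: subvector_def)
    qed
    show "subvector X' A ` space N = ?g ` subvector X A ` space M"
      by (simp add: spN S_def image_image sub cong: image_cong)
    fix y assume y: "y \<in> subvector X A ` space M"
    have "measure N (subvector X' A -` {?g y} \<inter> space N)
        = measure M (f -` (subvector X' A -` {?g y} \<inter> S) \<inter> space M)"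
      unfolding spN(1) unfolding N_def by (rule measure_distr[OF fm]) auto
    also have "f -` (subvector X' A -` {?g y} \<inter> S) \<inter> space M = subvector X A -` {y} \<inter> space M"
    proof -
      have "subvector X' A (f \<omega>) = ?g y \<longleftrightarrow> subvector X A \<omega> = y" if "\<omega> \<in> space M" for \<omega>
        unfolding sub[OF that] using inj_on_eq_iff[OF inj imageI[OF that] y] by simp
      then show ?thesis by (auto simp: S_def)
    qed
    finally show "measure N (subvector X' A -` {?g y} \<inter> space N)
        = measure M (subvector X A -` {y} \<inter> space M)" .
  qed
  then show ?thesis unfolding entropic_def using N X' h by metis
qed


lemma UNIV_4_set_cases: "card (A :: 4 set) =
    of_bool (1 \<in> A) + of_bool (2 \<in> A) + of_bool (3 \<in> A) + of_bool (4 \<in> A)"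
proof -
  have "card A = (\<Sum>i\<in>UNIV. of_bool (i \<in> A))" by simp
  then show ?thesis unfolding UNIV_4 by (simp del: sum_of_bool_eq)
qed

lemma U23_123_in_cone: "U23_123 \<in> polymatroid_cone"
  unfolding polymatroid_cone_def U23_123_def
  by (auto simp: UNIV_4_set_cases of_bool_def min_def)

lemma U14_in_cone: "U14 \<in> polymatroid_cone"
  unfolding polymatroid_cone_def U14_def
  by (auto simp: UNIV_4_set_cases of_bool_def min_def)

lemma face_point_in_cone:
  assumes "r1 \<in> polymatroid_cone" "r2 \<in> polymatroid_cone" "0 \<le> a" "0 \<le> b"
  shows "face_point r1 r2 a b \<in> polymatroid_cone"
proof -
  have sub: "(a * r1 $ (A \<union> B) + b * r2 $ (A \<union> B)) + (a * r1 $ (A \<inter> B) + b * r2 $ (A \<inter> B))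
      \<le> (a * r1 $ A + b * r2 $ A) + (a * r1 $ B + b * r2 $ B)" for A B
  proof -
    have "a * (r1 $ (A \<union> B) + r1 $ (A \<inter> B)) + b * (r2 $ (A \<union> B) + r2 $ (A \<inter> B))
        \<le> a * (r1 $ A + r1 $ B) + b * (r2 $ A + r2 $ B)"
      using assms unfolding polymatroid_cone_def by (intro add_mono[OF mult_left_mono mult_left_mono]) auto
    then show ?thesis by (simp add: algebra_simps)
  qed
  have mono: "a * r1 $ A + b * r2 $ A \<le> a * r1 $ B + b * r2 $ B" if "A \<subseteq> B" for A B
    using assms that unfolding polymatroid_cone_def by (intro add_mono[OF mult_left_mono mult_left_mono]) auto
  have "r1 $ {} = 0" "r2 $ {} = 0"
    using assms unfolding polymatroid_cone_def by auto
  then show ?thesis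
    using sub mono unfolding polymatroid_cone_def face_point_def by simp
qed

lemma all_4_set:
  assumes "P {}" "P {1}" "P {2}" "P {3}" "P {4}" "P {1,2}" "P {1,3}" "P {1,4}" "P {2,3}" "P {2,4}"
    "P {3,4}" "P {1,2,3}" "P {1,2,4}" "P {1,3,4}" "P {2,3,4}" "P {1,2,3,4}"
  shows "P (A :: 4 set)"
proof -
  have "A \<in> Pow {1, 2, 3, 4}" unfolding UNIV_4[symmetric] by simp
  then show ?thesis
    unfolding Pow_insert Pow_empty using assms by auto
qed

definition face_slack :: "real ^ (4 set) \<Rightarrow> real" where
  "face_slack h = (h $ {1,4} - h $ {1}) + (h $ {2,4} - h $ {2}) + (h $ {3,4} - h $ {3})
     + (h $ {1,2,3,4} - h $ {1,2}) + (h $ {1,2,3,4} - h $ {1,3}) + (h $ {1,2,3,4} - h $ {2,3})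
     + (h $ {1,4} + h $ {2,4} - h $ {1,2,4} - h $ {4})
     + (h $ {1,4} + h $ {3,4} - h $ {1,3,4} - h $ {4})
     + (h $ {2,4} + h $ {3,4} - h $ {2,3,4} - h $ {4})"

lemma face_slack:
  assumes h: "h \<in> polymatroid_cone"
  shows "0 \<le> face_slack h" and "face_slack h = 0 \<Longrightarrow> h \<in> spanned_face U23_123 U14"
proof -
  have m: "h $ A \<le> h $ B" if "A \<subseteq> B" for A B
    using h that unfolding polymatroid_cone_def by blast
  have sm: "h $ (A \<union> B) + h $ (A \<inter> B) \<le> h $ A + h $ B" for A B
    using h unfolding polymatroid_cone_def by blast
  have z: "h $ {} = 0" using h unfolding polymatroid_cone_def by blast
  have eqs: "{1,4} \<union> {2,4} = {1,2,4::4}" "{1,4} \<inter> {2,4} = {4::4}"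
    "{1,4} \<union> {3,4} = {1,3,4::4}" "{1,4} \<inter> {3,4} = {4::4}"
    "{2,4} \<union> {3,4} = {2,3,4::4}" "{2,4} \<inter> {3,4} = {4::4}" by auto
  have s1: "0 \<le> h $ {1,4} - h $ {1}" "0 \<le> h $ {2,4} - h $ {2}" "0 \<le> h $ {3,4} - h $ {3}"
    "0 \<le> h $ {1,2,3,4} - h $ {1,2}" "0 \<le> h $ {1,2,3,4} - h $ {1,3}"
    "0 \<le> h $ {1,2,3,4} - h $ {2,3}"
    by (auto intro!: m)
  have s2: "0 \<le> h $ {1,4} + h $ {2,4} - h $ {1,2,4} - h $ {4}"
    "0 \<le> h $ {1,4} + h $ {3,4} - h $ {1,3,4} - h $ {4}"
    "0 \<le> h $ {2,4} + h $ {3,4} - h $ {2,3,4} - h $ {4}"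
    using sm[of "{1,4}" "{2,4}"] sm[of "{1,4}" "{3,4}"] sm[of "{2,4}" "{3,4}"]
    unfolding eqs by linarith+
  show "0 \<le> face_slack h" unfolding face_slack_def using s1 s2 by linarith
  assume "face_slack h = 0"
  note t0 = this[unfolded face_slack_def]
  have t: "h $ {1,4} = h $ {1}" "h $ {2,4} = h $ {2}" "h $ {3,4} = h $ {3}"
    "h $ {1,2} = h $ {1,2,3,4}" "h $ {1,3} = h $ {1,2,3,4}" "h $ {2,3} = h $ {1,2,3,4}"
    "h $ {1,4} + h $ {2,4} = h $ {1,2,4} + h $ {4}" "h $ {1,4} + h $ {3,4} = h $ {1,3,4} + h $ {4}"
    "h $ {2,4} + h $ {3,4} = h $ {2,3,4} + h $ {4}"
    using t0 s1 s2 by linarith+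
  have q: "h $ {1,2,3} = h $ {1,2,3,4}" "h $ {1,2,4} = h $ {1,2,3,4}"
    "h $ {1,3,4} = h $ {1,2,3,4}" "h $ {2,3,4} = h $ {1,2,3,4}"
    using m[of "{1,2}" "{1,2,3}"] m[of "{1,2}" "{1,2,4}"] m[of "{1,3}" "{1,3,4}"]
      m[of "{2,3}" "{2,3,4}"] m[of "{1,2,3}" "{1,2,3,4}"] m[of "{1,2,4}" "{1,2,3,4}"]
      m[of "{1,3,4}" "{1,2,3,4}"] m[of "{2,3,4}" "{1,2,3,4}"] t(4-6) by auto
  have d: "h $ {2} = h $ {1}" "h $ {3} = h $ {1}" "h $ {1,2,3,4} = 2 * h $ {1} - h $ {4}"
    using t q by linarith+
  have "h = face_point U23_123 U14 (h $ {1} - h $ {4}) (h $ {4})"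
    unfolding vec_eq_iff
    by (intro allI, rule all_4_set)
      (simp_all add: face_point_def U23_123_def U14_def UNIV_4_set_cases z t q d)
  moreover have "0 \<le> h $ {1} - h $ {4}" "0 \<le> h $ {4}"
    using m[of "{4}" "{1,4}"] m[of "{}" "{4}"] t z by auto
  ultimately show "h \<in> spanned_face U23_123 U14" unfolding spanned_face_def by blast
qed

lemma spanned_face_face_of: "spanned_face U23_123 U14 face_of polymatroid_cone"
proof -
  have "face_slack (face_point U23_123 U14 a b) = 0" for a b
    by (simp add: face_slack_def face_point_def U23_123_def U14_def UNIV_4_set_cases)
  then have slack: "face_slack h = 0" if "h \<in> spanned_face U23_123 U14" for h
    using that unfolding spanned_face_def by auto
  have lin: "face_slack ((1 - u) *\<^sub>R g + u *\<^sub>R h) = (1 - u) * face_slack g + u * face_slack h"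
    for u g h by (simp add: face_slack_def algebra_simps)
  have sub: "spanned_face U23_123 U14 \<subseteq> polymatroid_cone"
    unfolding spanned_face_def using face_point_in_cone[OF U23_123_in_cone U14_in_cone] by auto
  have conv: "convex (spanned_face U23_123 U14)"
  proof (rule convexI)
    fix x y u v :: "_" assume x: "x \<in> spanned_face U23_123 U14" and y: "y \<in> spanned_face U23_123 U14"
      and u: "0 \<le> (u::real)" and v: "0 \<le> (v::real)"
    from x y obtain a b c d where abcd: "x = face_point U23_123 U14 a b" "y = face_point U23_123 U14 c d"
      "0 \<le> a" "0 \<le> b" "0 \<le> c" "0 \<le> d" unfolding spanned_face_def by auto
    have "u *\<^sub>R x + v *\<^sub>R y = face_point U23_123 U14 (u * a + v * c) (u * b + v * d)"
      by (simp add: abcd face_point_def algebra_simps)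
    then show "u *\<^sub>R x + v *\<^sub>R y \<in> spanned_face U23_123 U14"
      unfolding spanned_face_def using abcd u v by (auto intro!: add_nonneg_nonneg mult_nonneg_nonneg)
  qed
  have "g \<in> spanned_face U23_123 U14 \<and> h \<in> spanned_face U23_123 U14"
    if g: "g \<in> polymatroid_cone" and h: "h \<in> polymatroid_cone"
      and x: "x \<in> spanned_face U23_123 U14" and seg: "x \<in> open_segment g h" for g h x
  proof -
    obtain u where u: "0 < u" "u < 1" "x = (1 - u) *\<^sub>R g + u *\<^sub>R h"
      using seg by (auto simp: in_segment)
    have "(1 - u) * face_slack g + u * face_slack h = 0"
      using slack[OF x] lin u(3) by simp
    moreover have "0 \<le> (1 - u) * face_slack g" "0 \<le> u * face_slack h"
      using u face_slack(1)[OF g] face_slack(1)[OF h] by simp_all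
    ultimately have "(1 - u) * face_slack g = 0" "u * face_slack h = 0" by linarith+
    then show ?thesis using u face_slack(2)[OF g] face_slack(2)[OF h] by simp
  qed
  then show ?thesis unfolding face_of_def using sub conv by blast
qed

end

theory Submission
  imports Defs "HOL-Real_Asymp.Real_Asymp"
begin

text \<open>
  On the face, \<open>X\<^sub>4\<close> is a function of each of \<open>X\<^sub>1, X\<^sub>2, X\<^sub>3\<close>, and conditionally on \<open>X\<^sub>4\<close> these three are
  pairwise independent with each determined by the other two.  The joint probabilities then
  satisfy \<open>p(x) p(y) = p(x, y) = p(x, y, z) = p(x, z) = p(x) p(z)\<close>, so the conditional law is uniform on a
  Latin square of some order \<open>v\<close>.  If \<open>b = H(X\<^sub>4) = 0\<close> this forces \<open>a = log v\<close>.  If \<open>b > 0\<close>, mixing Latin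
  squares of orders \<open>w k\<close> with weights \<open>q k\<close> realises \<open>a = \<Sum> q k log (w k)\<close> and \<open>b = H(q)\<close>: a single large
  square of order \<open>v\<close> and weight \<open>a / log v\<close> gives \<open>a\<close>, and trivial squares of adjustable weights
  bring the entropy of \<open>q\<close> to \<open>b\<close>.
\<close>

section \<open>Equality cases of entropy inequalities\<close>

text \<open>Equality case of Gibbs' inequality. Each \<open>d x\<close> is nonnegative and vanishes
  only if \<open>p x = q x\<close>, because ln u is at most u - 1 with equality only at u = 1. The
  assumptions make the sum of \<open>d\<close> nonpositive, so every term is zero.\<close>

lemma Gibbs_equality:
  fixes p q :: "'a \<Rightarrow> real"
  assumes S: "finite S" and p: "\<And>x. x \<in> S \<Longrightarrow> 0 \<le> p x" and q: "\<And>x. x \<in> S \<Longrightarrow> 0 \<le> q x"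
    and pq: "\<And>x. x \<in> S \<Longrightarrow> 0 < p x \<Longrightarrow> 0 < q x"
    and sums: "sum q S \<le> sum p S"
    and le: "(\<Sum>x\<in>S. p x * log 2 (p x)) \<le> (\<Sum>x\<in>S. p x * log 2 (q x))"
    and x: "x \<in> S"
  shows "p x = q x"
proof -
  define d where "d x = p x * ln (p x) - p x * ln (q x) - (p x - q x)" for x
  have d: "0 \<le> d y \<and> (d y = 0 \<longrightarrow> p y = q y)" if "y \<in> S" for y
  proof (cases "p y = 0")
    case True
    then show ?thesis using q[OF that] by (simp add: d_def)
  next
    case False
    then have P: "0 < p y" "0 < q y" using p[OF that] pq[OF that] by auto
    have "d y = p y * (q y / p y - 1 - ln (q y / p y))"
      using P by (simp add: d_def ln_div field_simps)
    moreover have "0 \<le> q y / p y - 1 - ln (q y / p y)"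
      using ln_le_minus_one[of "q y / p y"] P by simp
    moreover have "p y = q y" if "q y / p y - 1 - ln (q y / p y) = 0"
      using ln_eq_minus_one[of "q y / p y"] P that by simp
    ultimately show ?thesis using P by simp
  qed
  have "(\<Sum>x\<in>S. p x * ln (p x)) \<le> (\<Sum>x\<in>S. p x * ln (q x))"
    using le by (simp add: log_def sum_divide_distrib[symmetric] divide_le_cancel)
  then have "sum d S \<le> 0"
    using sums by (simp add: d_def sum_subtractf)
  then have "sum d S = 0"
    using d by (meson antisym sum_nonneg)
  then show ?thesis
    using d x by (simp add: sum_nonneg_eq_0_iff[OF S])
qed

lemma measure_vimage_comp:
  assumes "prob_space M" and Y: "simple_function M Y"
  shows "measure M ((\<lambda>\<omega>. g (Y \<omega>)) -` {z} \<inter> space M) =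
    (\<Sum>y | y \<in> Y ` space M \<and> g y = z. measure M (Y -` {y} \<inter> space M))"
proof -
  interpret prob_space M by fact
  let ?R = "{y \<in> Y ` space M. g y = z}"
  have "(\<lambda>\<omega>. g (Y \<omega>)) -` {z} \<inter> space M = (\<Union>y\<in>?R. Y -` {y} \<inter> space M)" by auto
  also have "measure M \<dots> = (\<Sum>y\<in>?R. measure M (Y -` {y} \<inter> space M))"
    using Y by (intro finite_measure_finite_Union)
      (auto simp: simple_function_def disjoint_family_on_def)
  finally show ?thesis .
qed

lemma shannon_entropy_comp:
  assumes M: "prob_space M" and Y: "simple_function M Y"
  shows "shannon_entropy M (\<lambda>\<omega>. g (Y \<omega>)) = - (\<Sum>y\<in>Y ` space M.
    measure M (Y -` {y} \<inter> space M) * log 2 (measure M ((\<lambda>\<omega>. g (Y \<omega>)) -` {g y} \<inter> space M)))"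
proof -
  have fin: "finite (Y ` space M)" using Y by (rule simple_functionD)
  have img: "(\<lambda>\<omega>. g (Y \<omega>)) ` space M = g ` Y ` space M" by auto
  show ?thesis
    unfolding shannon_entropy_simple[OF M simple_function_compose1[OF Y]]
      sum.image_gen[OF fin, of _ g] img
    by (simp add: measure_vimage_comp[OF M Y] sum_distrib_right)
qed

lemma sum_prob_vimage_eq_one:
  assumes "prob_space M" "simple_function M Y"
  shows "(\<Sum>y\<in>Y ` space M. measure M (Y -` {y} \<inter> space M)) = 1"
  using measure_vimage_comp[OF assms, of "\<lambda>_. ()" "()"] prob_space.prob_space[OF assms(1)] by simp

text \<open>The difference of the two entropies is a sum of terms
  \<open>?p y * (log 2 (?q y) - log 2 (?p y))\<close>, nonnegative since the fibre of
  \<open>g y\<close> contains that of \<open>y\<close>. Equality kills each term, so almost surely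
  \<open>g\<close> loses no information.\<close>

lemma shannon_entropy_comp_eq:
  assumes M: "prob_space M" and Y: "simple_function M Y"
    and eq: "shannon_entropy M (\<lambda>\<omega>. g (Y \<omega>)) = shannon_entropy M Y"
    and pos: "0 < measure M (Y -` {y} \<inter> space M)"
  shows "measure M ((\<lambda>\<omega>. g (Y \<omega>)) -` {g y} \<inter> space M) = measure M (Y -` {y} \<inter> space M)"
proof -
  interpret prob_space M by fact
  let ?p = "\<lambda>y. measure M (Y -` {y} \<inter> space M)"
  let ?q = "\<lambda>y. measure M ((\<lambda>\<omega>. g (Y \<omega>)) -` {g y} \<inter> space M)"
  have fin: "finite (Y ` space M)" using Y by (rule simple_functionD)
  have le: "?p y \<le> ?q y" for y
    using simple_functionD(2)[OF simple_function_compose1[OF Y, of g], of "{g y}"]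
    by (intro finite_measure_mono) auto
  have "(\<Sum>y\<in>Y ` space M. ?p y * (log 2 (?q y) - log 2 (?p y))) = 0"
    using eq unfolding shannon_entropy_comp[OF M Y] shannon_entropy_simple[OF M Y]
    by (simp add: right_diff_distrib sum_subtractf)
  moreover have "0 \<le> ?p y * (log 2 (?q y) - log 2 (?p y))" for y
  proof (cases "?p y = 0")
    case False
    then have "0 < ?p y" by (simp add: less_le)
    then show ?thesis using le[of y] by (auto intro!: mult_nonneg_nonneg)
  qed simp
  ultimately have all: "?p y * (log 2 (?q y) - log 2 (?p y)) = 0" if "y \<in> Y ` space M" for y
    using that by (subst (asm) sum_nonneg_eq_0_iff[OF fin]) auto
  have "y \<in> Y ` space M"
  proof (rule ccontr)
    assume "y \<notin> Y ` space M"
    then have "Y -` {y} \<inter> space M = {}" by auto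
    with pos show False by simp
  qed
  from all[OF this] pos have "log 2 (?q y) = log 2 (?p y)" by auto
  moreover have "0 < ?q y" using le[of y] pos by linarith
  ultimately show ?thesis using pos by (simp add: log_def)
qed

text \<open>Additivity says that the relative entropy of the joint law with respect to the product
  of the marginals is zero; the equality case of Gibbs' inequality then identifies the two
  laws.\<close>

lemma shannon_entropy_additive_imp_indep:
  assumes M: "prob_space M" and X: "simple_function M X" and Y: "simple_function M Y"
    and add: "shannon_entropy M (\<lambda>\<omega>. (X \<omega>, Y \<omega>)) = shannon_entropy M X + shannon_entropy M Y"
  shows "measure M ((\<lambda>\<omega>. (X \<omega>, Y \<omega>)) -` {(x, y)} \<inter> space M) =
    measure M (X -` {x} \<inter> space M) * measure M (Y -` {y} \<inter> space M)"
proof -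
  interpret prob_space M by fact
  let ?Z = "\<lambda>\<omega>. (X \<omega>, Y \<omega>)"
  define p where "p z = measure M (?Z -` {z} \<inter> space M)" for z
  define px where "px x = measure M (X -` {x} \<inter> space M)" for x
  define py where "py y = measure M (Y -` {y} \<inter> space M)" for y
  have Z: "simple_function M ?Z" using X Y by (rule simple_function_Pair)
  \<comment> \<open>The product law has mass one on the full rectangle \<open>R\<close>, which may
    exceed the range of the pair, so the joint law is extended to it by zero.\<close>
  define R where "R = X ` space M \<times> Y ` space M"
  have finR: "finite R" unfolding R_def using X Y by (auto dest: simple_functionD)
  have ZR: "?Z ` space M \<subseteq> R" by (auto simp: R_def)
  have p0: "p z = 0" if "z \<notin> ?Z ` space M" for z
  proof -
    have "?Z -` {z} \<inter> space M = {}" using that by auto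
    then show ?thesis by (simp add: p_def)
  qed
  have ext: "(\<Sum>z\<in>?Z ` space M. p z * f z) = (\<Sum>z\<in>R. p z * f z)" for f
    using p0 by (intro sum.mono_neutral_left finR ZR) auto
  have le: "p z \<le> px (fst z)" "p z \<le> py (snd z)" for z
    unfolding p_def px_def py_def using simple_functionD(2)[OF X] simple_functionD(2)[OF Y]
    by (auto intro!: finite_measure_mono)
  have HX: "shannon_entropy M X = - (\<Sum>z\<in>R. p z * log 2 (px (fst z)))"
    using shannon_entropy_comp[OF M Z, of fst] by (simp add: ext p_def[symmetric] px_def[symmetric])
  have HY: "shannon_entropy M Y = - (\<Sum>z\<in>R. p z * log 2 (py (snd z)))"
    using shannon_entropy_comp[OF M Z, of snd] by (simp add: ext p_def[symmetric] py_def[symmetric])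
  have HZ: "shannon_entropy M ?Z = - (\<Sum>z\<in>R. p z * log 2 (p z))"
    using shannon_entropy_simple[OF M Z] by (simp add: ext p_def[symmetric])
  have pos: "0 < px (fst z)" "0 < py (snd z)" if "0 < p z" for z
    using le[of z] that by linarith+
  have "(\<Sum>z\<in>R. p z * log 2 (px (fst z) * py (snd z))) =
      (\<Sum>z\<in>R. p z * log 2 (px (fst z)) + p z * log 2 (py (snd z)))"
  proof (rule sum.cong[OF refl])
    fix z
    show "p z * log 2 (px (fst z) * py (snd z)) = p z * log 2 (px (fst z)) + p z * log 2 (py (snd z))"
    proof (cases "p z = 0")
      case False
      then have "0 < p z" using measure_nonneg[of M] by (simp add: p_def less_le)
      then show ?thesis using pos[of z] by (simp add: log_mult distrib_left)
    qed simp
  qed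
  also have "\<dots> = (\<Sum>z\<in>R. p z * log 2 (p z))"
    using add unfolding HX HY HZ by (simp add: sum.distrib)
  finally have eq: "(\<Sum>z\<in>R. p z * log 2 (p z)) \<le> (\<Sum>z\<in>R. p z * log 2 (px (fst z) * py (snd z)))"
    by simp
  have "(\<Sum>z\<in>R. px (fst z) * py (snd z)) = 1"
    using sum_prob_vimage_eq_one[OF M X] sum_prob_vimage_eq_one[OF M Y]
    unfolding R_def px_def py_def
    by (simp add: sum.cartesian_product' sum_product[symmetric])
  also have "1 = (\<Sum>z\<in>R. p z)"
    using sum_prob_vimage_eq_one[OF M Z] ext[of "\<lambda>_. 1"] by (simp add: p_def[symmetric])
  finally have sums: "(\<Sum>z\<in>R. px (fst z) * py (snd z)) \<le> sum p R" by simp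
  have "p z = px (fst z) * py (snd z)" if "z \<in> R" for z
    by (rule Gibbs_equality[OF finR _ _ _ sums eq that])
      (auto simp: pos, auto simp: p_def px_def py_def)
  moreover have "p z = px (fst z) * py (snd z)" if "z \<notin> R" for z
  proof -
    obtain x y where z: "z = (x, y)" by (cases z)
    have "X -` {x} \<inter> space M = {} \<or> Y -` {y} \<inter> space M = {}"
      using that by (auto simp: R_def z)
    then have "px (fst z) * py (snd z) = 0" by (auto simp: px_def py_def z)
    then show ?thesis using p0 that ZR by (metis subsetD)
  qed
  ultimately have "p (x, y) = px (fst (x, y)) * py (snd (x, y))" by blast
  then show ?thesis by (simp add: p_def px_def py_def)
qed


section \<open>Necessity on the ray \<open>b = 0\<close>\<close>

lemma shannon_entropy_inj_on_comp:
  assumes M: "prob_space M" and Y: "simple_function M Y" and g: "inj_on g (Y ` space M)"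
  shows "shannon_entropy M (\<lambda>\<omega>. g (Y \<omega>)) = shannon_entropy M Y"
proof (rule shannon_entropy_inj[OF M M Y simple_function_compose1[OF Y] g])
  fix y assume "y \<in> Y ` space M"
  then have "(\<lambda>\<omega>. g (Y \<omega>)) -` {g y} \<inter> space M = Y -` {y} \<inter> space M"
    using g by (auto dest: inj_onD)
  then show "measure M ((\<lambda>\<omega>. g (Y \<omega>)) -` {g y} \<inter> space M) = measure M (Y -` {y} \<inter> space M)"
    by simp
qed auto

text \<open>If \<open>y\<close> and \<open>z\<close> have positive mass, independence of
  \<open>Y\<close> and \<open>Z\<close> gives some \<open>x\<close> with (x, y, z) of positive mass.
  That mass is both \<open>px x * py y\<close> and \<open>px x * pz z\<close>, hence
  \<open>py y = pz z\<close>. Fixing one \<open>z\<close> shows that \<open>Y\<close> is uniform on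
  its support, whose size is the required \<open>v\<close>.\<close>

lemma shannon_entropy_latin_square:
  assumes M: "prob_space M"
    and X: "simple_function M X" and Y: "simple_function M Y" and Z: "simple_function M Z"
    and XY: "shannon_entropy M (\<lambda>\<omega>. (X \<omega>, Y \<omega>)) = shannon_entropy M X + shannon_entropy M Y"
    and XZ: "shannon_entropy M (\<lambda>\<omega>. (X \<omega>, Z \<omega>)) = shannon_entropy M X + shannon_entropy M Z"
    and YZ: "shannon_entropy M (\<lambda>\<omega>. (Y \<omega>, Z \<omega>)) = shannon_entropy M Y + shannon_entropy M Z"
    and XYZ: "shannon_entropy M (\<lambda>\<omega>. (X \<omega>, Y \<omega>, Z \<omega>)) = shannon_entropy M (\<lambda>\<omega>. (X \<omega>, Y \<omega>))"
      "shannon_entropy M (\<lambda>\<omega>. (X \<omega>, Y \<omega>, Z \<omega>)) = shannon_entropy M (\<lambda>\<omega>. (X \<omega>, Z \<omega>))"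
  shows "\<exists>v::nat. v > 0 \<and> shannon_entropy M Y = log 2 (real v)"
proof -
  interpret prob_space M by fact
  let ?T = "\<lambda>\<omega>. (X \<omega>, Y \<omega>, Z \<omega>)"
  define px where "px x = measure M (X -` {x} \<inter> space M)" for x
  define py where "py y = measure M (Y -` {y} \<inter> space M)" for y
  define pz where "pz z = measure M (Z -` {z} \<inter> space M)" for z
  define p where "p t = measure M (?T -` {t} \<inter> space M)" for t
  have T: "simple_function M ?T" using X Y Z by (intro simple_function_Pair)
  have eq: "py y = pz z" if y: "0 < py y" and z: "0 < pz z" for y z
  proof -
    have "0 < measure M ((\<lambda>\<omega>. (Y \<omega>, Z \<omega>)) -` {(y, z)} \<inter> space M)"
      using shannon_entropy_additive_imp_indep[OF M Y Z YZ] y z by (simp add: py_def pz_def)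
    also have "(\<lambda>\<omega>. (Y \<omega>, Z \<omega>)) = (\<lambda>\<omega>. snd (?T \<omega>))" by simp
    finally have "0 < (\<Sum>t | t \<in> ?T ` space M \<and> snd t = (y, z). p t)"
      unfolding measure_vimage_comp[OF M T] p_def .
    then obtain t where t: "snd t = (y, z)" "0 < p t"
      by (metis (mono_tags, lifting) mem_Collect_eq not_less sum_nonpos)
    then obtain x where x: "t = (x, y, z)" by (cases t) auto
    have "px x * py y = p t"
      using shannon_entropy_comp_eq[OF M T, of "\<lambda>(x, y, z). (x, y)" t] t x XYZ(1)
        shannon_entropy_additive_imp_indep[OF M X Y XY]
      by (simp add: px_def py_def p_def)
    moreover have "px x * pz z = p t"
      using shannon_entropy_comp_eq[OF M T, of "\<lambda>(x, y, z). (x, z)" t] t x XYZ(2)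
        shannon_entropy_additive_imp_indep[OF M X Z XZ]
      by (simp add: px_def pz_def p_def)
    \<comment> \<open>Positivity of \<open>p t\<close> makes \<open>px x\<close> nonzero, so it
      cancels.\<close>
    ultimately show ?thesis using t(2) by (metis less_irrefl mult_cancel_left mult_zero_left)
  qed
  have finY: "finite (Y ` space M)" using Y by (rule simple_functionD)
  have sumY: "sum py (Y ` space M) = 1"
    using sum_prob_vimage_eq_one[OF M Y] by (simp add: py_def)
  have sumZ: "sum pz (Z ` space M) = 1"
    using sum_prob_vimage_eq_one[OF M Z] by (simp add: pz_def)
  have "\<exists>z. 0 < pz z"
    using sumZ by (metis not_less sum_nonpos zero_less_one)
  then obtain z where z: "0 < pz z" ..
  \<comment> \<open>The range may contain values of probability zero; only the support counts
    towards \<open>v\<close>.\<close>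
  define S where "S = {y \<in> Y ` space M. 0 < py y}"
  have finS: "finite S" using finY by (simp add: S_def)
  have S: "py y = pz z" if "y \<in> S" for y
    using that eq z by (simp add: S_def)
  have supp: "(\<Sum>y\<in>Y ` space M. py y * f y) = (\<Sum>y\<in>S. py y * f y)" for f
    by (intro sum.mono_neutral_right finY) (auto simp: S_def py_def less_le)
  have 1: "real (card S) * pz z = 1"
    using supp[of "\<lambda>_. 1"] sumY S by simp
  then have pos: "card S > 0" by (intro Nat.gr0I) auto
  have "shannon_entropy M Y = - (\<Sum>y\<in>S. py y * log 2 (py y))"
    unfolding shannon_entropy_simple[OF M Y] py_def[symmetric] supp ..
  also have "\<dots> = - log 2 (pz z)"
    using 1 S by (simp add: mult.assoc[symmetric])
  also have "pz z = 1 / real (card S)" using 1 pos by (simp add: field_simps)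
  also have "- log 2 (1 / real (card S)) = log 2 (real (card S))"
    using pos by (simp add: log_divide)
  finally show ?thesis using pos by blast
qed

text \<open>For \<open>b = 0\<close> the first three coordinates have entropy \<open>a\<close>
  singly, and \<open>2 * a\<close> in pairs and all together, which is exactly the Latin square
  situation.\<close>

lemma entropic_face_point_boundary:
  assumes "entropic (face_point U23_123 U14 a 0)"
  shows "\<exists>v::nat. v > 0 \<and> a = log 2 (real v)"
proof -
  obtain M :: "nat measure" and X :: "4 \<Rightarrow> nat \<Rightarrow> nat" where M: "prob_space M"
    and X: "\<And>i. simple_function M (X i)"
    and h: "\<And>A. face_point U23_123 U14 a 0 $ A = shannon_entropy M (subvector X A)"
    using assms unfolding entropic_def by blast
  note sub = simple_function_subvector[of M X, OF X]
  have H: "a * real (min 2 (card (A \<inter> {1, 2, 3}))) = shannon_entropy M (subvector X A)" for A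
    using h[of A] by (simp add: face_point_def U23_123_def)
  \<comment> \<open>Evaluation at the indices is injective on subvectors, so tuples may replace
    them.\<close>
  have single: "shannon_entropy M (X i) = shannon_entropy M (subvector X {i})" for i
    using shannon_entropy_inj_on_comp[OF M sub, of "\<lambda>f. f i" "{i}"]
    by (auto simp: inj_on_def subvector_def fun_eq_iff)
  have pair: "shannon_entropy M (\<lambda>\<omega>. (X i \<omega>, X j \<omega>)) = shannon_entropy M (subvector X {i, j})" for i j
    using shannon_entropy_inj_on_comp[OF M sub, of "\<lambda>f. (f i, f j)" "{i, j}"]
    by (auto simp: inj_on_def subvector_def fun_eq_iff)
  have triple: "shannon_entropy M (\<lambda>\<omega>. (X i \<omega>, X j \<omega>, X k \<omega>)) =
      shannon_entropy M (subvector X {i, j, k})" for i j k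
    using shannon_entropy_inj_on_comp[OF M sub, of "\<lambda>f. (f i, f j, f k)" "{i, j, k}"]
    by (auto simp: inj_on_def subvector_def fun_eq_iff)
  have "\<exists>v::nat. v > 0 \<and> shannon_entropy M (X 2) = log 2 (real v)"
    by (rule shannon_entropy_latin_square[OF M X[of 1] X[of 2] X[of 3]])
      (simp_all add: single pair triple H[symmetric] UNIV_4_set_cases)
  then show ?thesis by (simp add: single H[symmetric] UNIV_4_set_cases)
qed

section \<open>Entropic points from mixtures of Latin squares\<close>

lemma mod_add_left_cancel_nat:
  fixes x y z w :: nat
  assumes "(x + y) mod w = (x + z) mod w" "y < w" "z < w"
  shows "y = z"
proof -
  obtain a b where "x + y + w * a = x + z + w * b"
    using assms(1) nat_mod_eq_iff by blast
  then have "y + w * a = z + w * b" by simp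
  then have "y mod w = z mod w" using nat_mod_eq_iff by blast
  then show ?thesis using assms by simp
qed

text \<open>Any two of row, column and symbol determine the cell. So prescribing none, one, or at
  least two of them leaves w^2, w or 1 cells, and the exponent is the corank in
  \<open>U23_123\<close>.\<close>

lemma card_latin_square_fibre:
  fixes x y w :: nat and A :: "4 set"
  assumes x: "x < w" and y: "y < w"
  shows "card {(x', y'). x' < w \<and> y' < w \<and> (1 \<in> A \<longrightarrow> x' = x) \<and> (2 \<in> A \<longrightarrow> y' = y) \<and>
      (3 \<in> A \<longrightarrow> (x' + y') mod w = (x + y) mod w)} = w ^ (2 - min 2 (card (A \<inter> {1, 2, 3})))"
    (is "card ?F = _")
proof -
  have c1: "y' = y" if "(x + y') mod w = (x + y) mod w" "y' < w" for y'
    using mod_add_left_cancel_nat[OF that(1)] that y by simp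
  have c2: "x' = x" if "(x' + y) mod w = (x + y) mod w" "x' < w" for x'
    using mod_add_left_cancel_nat[of y x' w x] that x by (simp add: add.commute)
  consider (none) "1 \<notin> A" "2 \<notin> A" "3 \<notin> A" | (one) "1 \<in> A" "2 \<notin> A" "3 \<notin> A"
    | (two) "1 \<notin> A" "2 \<in> A" "3 \<notin> A" | (three) "1 \<notin> A" "2 \<notin> A" "3 \<in> A"
    | (many) "1 \<in> A \<and> 2 \<in> A \<or> 1 \<in> A \<and> 3 \<in> A \<or> 2 \<in> A \<and> 3 \<in> A" by blast
  then show ?thesis
  proof cases
    case none
    then have "?F = {..<w} \<times> {..<w}" by auto
    then show ?thesis using none by (simp add: UNIV_4_set_cases power2_eq_square)
  next
    case one
    then have "?F = {x} \<times> {..<w}" using x by auto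
    then show ?thesis using one by (simp add: UNIV_4_set_cases card_cartesian_product)
  next
    case two
    then have "?F = {..<w} \<times> {y}" using y by auto
    then show ?thesis using two by (simp add: UNIV_4_set_cases card_cartesian_product)
  next
    case three
    \<comment> \<open>The column in row \<open>x'\<close> that carries the prescribed symbol;
      \<open>w - x'\<close> represents -x' modulo \<open>w\<close> without truncated
      subtraction.\<close>
    let ?g = "\<lambda>x'. (w - x' + (x + y)) mod w"
    have g: "(x' + ?g x') mod w = (x + y) mod w" if "x' < w" for x'
    proof -
      have "(x' + ?g x') mod w = (x' + (w - x' + (x + y))) mod w" by (rule mod_add_right_eq)
      also have "x' + (w - x' + (x + y)) = w + (x + y)" using that by simp
      finally show ?thesis by simp
    qed
    have "?F = (\<lambda>x'. (x', ?g x')) ` {..<w}"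
    proof (intro set_eqI iffI)
      fix t assume "t \<in> ?F"
      then obtain x' y' where t: "t = (x', y')" "x' < w" "y' < w" "(x' + y') mod w = (x + y) mod w"
        using three by auto
      then have "y' = ?g x'" using g[of x'] by (intro mod_add_left_cancel_nat[of x' y' w]) auto
      then show "t \<in> (\<lambda>x'. (x', ?g x')) ` {..<w}" using t by auto
    next
      fix t assume "t \<in> (\<lambda>x'. (x', ?g x')) ` {..<w}"
      then show "t \<in> ?F" using three g x by auto
    qed
    moreover have "inj_on (\<lambda>x'. (x', ?g x')) {..<w}" by (auto simp: inj_on_def)
    ultimately have "card ?F = w" by (simp only: card_image card_lessThan)
    then show ?thesis using three by (simp add: UNIV_4_set_cases)
  next
    case many
    then have "?F = {(x, y)}" using c1 c2 x y by auto
    moreover have "min 2 (card (A \<inter> {1, 2, 3})) = 2" using many by (auto simp: UNIV_4_set_cases)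
    ultimately show ?thesis by simp
  qed
qed

text \<open>
  Conditionally on \<open>X\<^sub>4 = k\<close>, the vector \<open>(X\<^sub>1, X\<^sub>2, X\<^sub>3)\<close> is uniform on the addition table of
  the integers modulo \<open>w k\<close>; every \<open>X\<^sub>i\<close> carries the index \<open>k\<close>.
\<close>

lemma entropic_mixture:
  fixes q :: "nat \<Rightarrow> real" and w :: "nat \<Rightarrow> nat"
  assumes K: "finite K" and q: "\<And>k. k \<in> K \<Longrightarrow> 0 < q k" and w: "\<And>k. k \<in> K \<Longrightarrow> 0 < w k"
    and sum1: "sum q K = 1"
  shows "entropic (face_point U23_123 U14
    (\<Sum>k\<in>K. q k * log 2 (real (w k))) (- (\<Sum>k\<in>K. q k * log 2 (q k))))"
    (is "entropic (face_point _ _ ?a ?b)")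
proof -
  define \<Omega> where "\<Omega> = (SIGMA k:K. {..<w k} \<times> {..<w k})"
  \<comment> \<open>The weight \<open>q k\<close> is spread evenly over the \<open>w k\<close> ^ 2
    cells of square \<open>k\<close>.\<close>
  define p where "p = (\<lambda>(k, x :: nat, y :: nat). q k / real (w k) ^ 2)"
  define M where "M = point_measure \<Omega> (\<lambda>\<omega>. ennreal (p \<omega>))"
  define X where "X i = (\<lambda>(k, x, y). (k, if i = 1 then x else if i = 2 then y
    else if i = 3 then (x + y) mod w k else 0))" for i :: 4
  have fin: "finite \<Omega>" using K by (simp add: \<Omega>_def)
  have p0: "0 \<le> p \<omega>" if "\<omega> \<in> \<Omega>" for \<omega>
    using that q by (auto simp: p_def \<Omega>_def less_imp_le)
  have sum\<Omega>: "(\<Sum>\<omega>\<in>\<Omega>. p \<omega> * f (fst \<omega>)) = (\<Sum>k\<in>K. q k * f k)" for f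
  proof -
    have "(\<Sum>\<omega>\<in>\<Omega>. p \<omega> * f (fst \<omega>)) =
        (\<Sum>k\<in>K. \<Sum>t\<in>{..<w k} \<times> {..<w k}. p (k, t) * f k)"
      unfolding \<Omega>_def using K by (subst sum.Sigma) (auto simp: case_prod_unfold)
    also have "\<dots> = (\<Sum>k\<in>K. q k * f k)"
    proof (rule sum.cong[OF refl])
      fix k assume "k \<in> K"
      then show "(\<Sum>t\<in>{..<w k} \<times> {..<w k}. p (k, t) * f k) = q k * f k"
        using w[of k] by (simp add: p_def case_prod_unfold power2_eq_square)
    qed
    finally show ?thesis .
  qed
  have "sum p \<Omega> = 1" using sum\<Omega>[of "\<lambda>_. 1"] sum1 by simp
  then have M: "prob_space M"
    unfolding M_def using p0 fin by (intro prob_space_point_measure) simp_all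
  have sp: "space M = \<Omega>" by (simp add: M_def space_point_measure)
  have simple: "simple_function M f" for f :: "nat \<times> nat \<times> nat \<Rightarrow> 'z"
    using fin by (simp add: M_def)
  have ms: "measure M S = sum p S" if "S \<subseteq> \<Omega>" for S
    using that fin p0 by (simp add: M_def measure_point_measure_finite_if)
  have H: "shannon_entropy M f =
      - (\<Sum>\<omega>\<in>\<Omega>. p \<omega> * log 2 (sum p {\<omega>'\<in>\<Omega>. f \<omega>' = f \<omega>}))" for f :: "nat \<times> nat \<times> nat \<Rightarrow> 'z"
  proof -
    have "f -` {f \<omega>} \<inter> \<Omega> = {\<omega>'\<in>\<Omega>. f \<omega>' = f \<omega>}" for \<omega> by auto
    moreover have "(\<lambda>\<omega>. \<omega>) -` {\<omega>} \<inter> \<Omega> = {\<omega>}" if "\<omega> \<in> \<Omega>" for \<omega> using that by auto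
    ultimately show ?thesis
      using shannon_entropy_comp[OF M simple, of f "\<lambda>\<omega>. \<omega>"] by (simp add: sp ms)
  qed
  show ?thesis
  proof (rule entropicI[OF M simple, where X = X])
    fix A :: "4 set"
    let ?r = "min 2 (card (A \<inter> {1, 2, 3}))"
    show "face_point U23_123 U14 ?a ?b $ A = shannon_entropy M (subvector X A)"
    proof (cases "A = {}")
      case True
      then show ?thesis
        using \<open>sum p \<Omega> = 1\<close> by (simp add: H subvector_def restrict_def face_point_def U23_123_def U14_def)
    next
      case False
      \<comment> \<open>Each coordinate reveals the index \<open>k\<close>, so for nonempty
        \<open>A\<close> a fibre stays inside one square. For empty \<open>A\<close> the squares
        would be merged, hence the separate case.\<close>
      then have ne: "1 \<in> A \<or> 2 \<in> A \<or> 3 \<in> A \<or> 4 \<in> A"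
        by (metis all_not_in_conv exhaust_4)
      have pointwise: "p \<omega> * log 2 (sum p {\<omega>'\<in>\<Omega>. subvector X A \<omega>' = subvector X A \<omega>}) =
          p \<omega> * (log 2 (q (fst \<omega>)) - real ?r * log 2 (real (w (fst \<omega>))))" if \<omega>: "\<omega> \<in> \<Omega>" for \<omega>
      proof -
        obtain k x y where \<omega>k: "\<omega> = (k, x, y)" "k \<in> K" "x < w k" "y < w k"
          using \<omega> by (auto simp: \<Omega>_def)
        define F where "F = {(x', y'). x' < w k \<and> y' < w k \<and> (1 \<in> A \<longrightarrow> x' = x) \<and>
          (2 \<in> A \<longrightarrow> y' = y) \<and> (3 \<in> A \<longrightarrow> (x' + y') mod w k = (x + y) mod w k)}"
        have "subvector X A \<omega>' = subvector X A \<omega> \<longleftrightarrow> (\<forall>i\<in>A. X i \<omega>' = X i \<omega>)" for \<omega>'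
          by (auto simp: subvector_def fun_eq_iff restrict_def)
        moreover have "(\<forall>i\<in>A. X i (k', x', y') = X i (k, x, y)) \<longleftrightarrow> k' = k \<and> (1 \<in> A \<longrightarrow> x' = x) \<and>
            (2 \<in> A \<longrightarrow> y' = y) \<and> (3 \<in> A \<longrightarrow> (x' + y') mod w k = (x + y) mod w k)" for k' x' y'
          using ne unfolding Ball_def forall_4 X_def by auto
        ultimately have fibre: "subvector X A (k', x', y') = subvector X A \<omega> \<longleftrightarrow> k' = k \<and>
            (1 \<in> A \<longrightarrow> x' = x) \<and> (2 \<in> A \<longrightarrow> y' = y) \<and>
            (3 \<in> A \<longrightarrow> (x' + y') mod w k = (x + y) mod w k)" for k' x' y'
          unfolding \<omega>k(1) by blast
        have "{\<omega>'\<in>\<Omega>. subvector X A \<omega>' = subvector X A \<omega>} = {k} \<times> F"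
          using \<omega>k(2) by (auto simp: \<Omega>_def F_def fibre)
        then have "sum p {\<omega>'\<in>\<Omega>. subvector X A \<omega>' = subvector X A \<omega>} =
            (\<Sum>\<omega>'\<in>{k} \<times> F. q k / real (w k) ^ 2)"
          by (simp only:) (rule sum.cong, auto simp: p_def)
        also have "\<dots> = real (card F) * (q k / real (w k) ^ 2)"
          by (simp add: card_cartesian_product)
        also have "card F = w k ^ (2 - ?r)"
          unfolding F_def using \<omega>k(3,4) by (rule card_latin_square_fibre)
        also have "real (w k ^ (2 - ?r)) * (q k / real (w k) ^ 2) = q k / real (w k) ^ ?r"
          unfolding of_nat_power using w[OF \<omega>k(2)] by (subst power_diff) auto
        finally show ?thesis
          using q[OF \<omega>k(2)] w[OF \<omega>k(2)] by (simp add: \<omega>k(1) log_divide log_nat_power)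
      qed
      have "shannon_entropy M (subvector X A) =
          - (\<Sum>k\<in>K. q k * (log 2 (q k) - real ?r * log 2 (real (w k))))"
        unfolding H sum\<Omega>[symmetric] by (simp only: pointwise cong: sum.cong)
      also have "\<dots> = ?b + real ?r * ?a"
        by (simp add: right_diff_distrib sum_subtractf sum_distrib_left mult.left_commute)
      moreover have "min 1 (card A) = 1"
        using False finite[of A] by (simp add: min_def Suc_le_eq card_gt_0_iff)
      ultimately show ?thesis
        by (simp add: face_point_def U23_123_def U14_def)
    qed
  qed
qed

section \<open>All points with \<open>b > 0\<close>\<close>

text \<open>
  One atom of prescribed small mass \<open>s\<close>, one of mass \<open>(1 - s) (1 - t)\<close>, and \<open>n\<close> equal atoms
  sharing \<open>(1 - s) t\<close>: with \<open>n\<close> fixed, the entropy passes through \<open>b\<close> as \<open>t\<close> runs from \<open>s\<close> to \<open>1/2\<close>.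
\<close>

lemma eventually_distribution_with_entropy:
  assumes b: "0 < b"
  shows "\<forall>\<^sub>F s in at_right 0. \<exists>(n::nat) q :: nat \<Rightarrow> real. q 0 = s \<and> (\<forall>k\<le>n. 0 < q k) \<and>
    sum q {..n} = 1 \<and> - (\<Sum>k\<le>n. q k * log 2 (q k)) = b"
proof -
  define e where "e x = - (x * log 2 x)" for x :: real
  \<comment> \<open>At \<open>t = 1/2\<close> the \<open>n\<close> equal atoms share mass (1 - s)/2,
    at least 1/4, and so contribute at least log n / 4. This choice makes that at least
    \<open>b\<close> for every \<open>s < 1/2\<close>, so \<open>n\<close> can be fixed before
    \<open>s\<close> tends to 0.\<close>
  obtain n :: nat where n: "2 powr (4 * b) \<le> real n" using real_arch_simple by blast
  have "0 < 2 powr (4 * b)" by simp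
  then have n0: "0 < real n" using n by linarith
  have logn: "4 * b \<le> log 2 (real n)" using n n0 by (simp add: le_log_iff)
  define f where "f s t = e s + e ((1 - s) * (1 - t)) + real n * e ((1 - s) * t / real n)" for s t
  \<comment> \<open>At \<open>t = s\<close> one atom has mass tending to 1, so the entropy vanishes
    in the limit. Starting at \<open>s\<close> rather than 0 keeps all masses positive.\<close>
  have "((\<lambda>s. f s s) \<longlongrightarrow> 0) (at_right 0)"
    using n0 unfolding f_def e_def by real_asymp
  then have "\<forall>\<^sub>F s in at_right 0. f s s < b" using b by (rule order_tendstoD)
  moreover have "\<forall>\<^sub>F s in at_right 0. 0 < s \<and> s < (1/2 :: real)"
    by (intro eventually_conj eventually_at_right_less order_tendstoD(2)[OF tendsto_ident_at]) simp
  ultimately show ?thesis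
  proof eventually_elim
    case (elim s)
    then have s: "0 < s" "s < 1/2" and fs: "f s s \<le> b" by auto
    have e0: "0 \<le> e x" if "0 < x" "x \<le> 1" for x
      using that by (simp add: e_def mult_le_0_iff)
    have "1/4 * (4 * b) \<le> (1 - s) / 2 * (- log 2 ((1 - s) / 2 / real n))"
    proof (rule mult_mono)
      have "log 2 ((1 - s) / 2) \<le> 0" using s by simp
      moreover have "log 2 ((1 - s) / 2 / real n) = log 2 ((1 - s) / 2) - log 2 (real n)"
        using s n0 by (intro log_divide_pos) auto
      ultimately show "4 * b \<le> - log 2 ((1 - s) / 2 / real n)"
        using logn by linarith
    qed (use s b in auto)
    also have "\<dots> = real n * e ((1 - s) * (1/2) / real n)" using n0 by (simp add: e_def)
    also have "\<dots> \<le> f s (1/2)"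
      unfolding f_def using s e0[of s] e0[of "(1 - s) * (1 - 1/2)"] by simp
    finally have fb: "b \<le> f s (1/2)" by simp
    have "continuous_on {s..1/2} (f s)"
      unfolding f_def e_def log_def using s n0 by (intro continuous_intros) auto
    then obtain t where t: "s \<le> t" "t \<le> 1/2" "f s t = b"
      using IVT'[of "f s" s b "1/2"] fs fb s by auto
    \<comment> \<open>Indices 2 to \<open>Suc n\<close> hold the \<open>n\<close> equal atoms, so
      the bound passed on is \<open>Suc n\<close>.\<close>
    define q where "q k = (if k = 0 then s else if k = 1 then (1 - s) * (1 - t)
      else (1 - s) * t / real n)" for k :: nat
    have split: "(\<Sum>k\<le>Suc n. g (q k)) = g s + g ((1 - s) * (1 - t)) + real n * g ((1 - s) * t / real n)"
      for g :: "real \<Rightarrow> real"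
    proof -
      have "{..Suc n} = {0, 1} \<union> {2..Suc n}" using n0 by auto
      then have "(\<Sum>k\<le>Suc n. g (q k)) = (\<Sum>k\<in>{0, 1}. g (q k)) + (\<Sum>k\<in>{2..Suc n}. g (q k))"
        by (simp only:) (rule sum.union_disjoint, auto)
      also have "(\<Sum>k\<in>{2..Suc n}. g (q k)) = (\<Sum>k\<in>{2..Suc n}. g ((1 - s) * t / real n))"
        by (rule sum.cong) (auto simp: q_def)
      finally show ?thesis by (simp add: q_def)
    qed
    have "real n * ((1 - s) * t / real n) = (1 - s) * t" using n0 by simp
    then have "sum q {..Suc n} = s + (1 - s) * (1 - t) + (1 - s) * t"
      using split[of "\<lambda>x. x"] by (simp only:)
    then have "sum q {..Suc n} = 1" by (simp only:) (simp add: algebra_simps)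
    moreover have "- (\<Sum>k\<le>Suc n. q k * log 2 (q k)) = b"
      using split[of "\<lambda>x. x * log 2 x"] t(3) by (simp add: f_def e_def)
    moreover have "\<forall>k\<le>Suc n. 0 < q k" using s t n0 by (simp add: q_def)
    moreover have "q 0 = s" by (simp add: q_def)
    ultimately show ?case by blast
  qed
qed

text \<open>For \<open>a > 0\<close> the mass \<open>a / log 2 v\<close> tends to 0 from the right
  as \<open>v\<close> grows, so it is eventually an admissible mass of atom 0 in a distribution of
  entropy \<open>b\<close>. A square of order \<open>v\<close> on that atom contributes exactly
  \<open>a\<close>.\<close>

lemma entropic_face_point_interior:
  assumes a: "0 \<le> a" and b: "0 < b"
  shows "entropic (face_point U23_123 U14 a b)"
proof -
  have "\<exists>(v::nat) (n::nat) q :: nat \<Rightarrow> real. 0 < v \<and> (\<forall>k\<le>n. 0 < q k) \<and> sum q {..n} = 1 \<and>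
    - (\<Sum>k\<le>n. q k * log 2 (q k)) = b \<and> q 0 * log 2 (real v) = a"
  \<comment> \<open>For \<open>a = 0\<close> that mass would be 0, not a positive mass; squares of
    order 1 suffice.\<close>
  proof (cases "a = 0")
    case True
    obtain n :: nat and q :: "nat \<Rightarrow> real" where "\<forall>k\<le>n. 0 < q k" "sum q {..n} = 1"
      "- (\<Sum>k\<le>n. q k * log 2 (q k)) = b"
      using eventually_happens[OF eventually_distribution_with_entropy[OF b]] by auto
    then show ?thesis using True by (intro exI[of _ "1::nat"] exI[of _ n] exI[of _ q]) simp
  next
    case False
    then have "filterlim (\<lambda>v. a / log 2 (real v)) (at_right 0) sequentially"
      using a by real_asymp
    from eventually_compose_filterlim[OF eventually_distribution_with_entropy[OF b] this]
    have "\<forall>\<^sub>F v in sequentially. \<exists>(n::nat) q :: nat \<Rightarrow> real. q 0 = a / log 2 (real v) \<and>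
        (\<forall>k\<le>n. 0 < q k) \<and> sum q {..n} = 1 \<and> - (\<Sum>k\<le>n. q k * log 2 (q k)) = b" .
    \<comment> \<open>The bound \<open>1 < v\<close> makes the logarithm nonzero, so the mass of
      atom 0 times it is \<open>a\<close>.\<close>
    then have "\<forall>\<^sub>F v in sequentially. 1 < v \<and> (\<exists>(n::nat) q :: nat \<Rightarrow> real. q 0 = a / log 2 (real v) \<and>
        (\<forall>k\<le>n. 0 < q k) \<and> sum q {..n} = 1 \<and> - (\<Sum>k\<le>n. q k * log 2 (q k)) = b)"
      by (intro eventually_conj eventually_gt_at_top)
    then obtain v n :: nat and q :: "nat \<Rightarrow> real" where v: "1 < v" "q 0 = a / log 2 (real v)"
      and q: "\<forall>k\<le>n. 0 < q k" "sum q {..n} = 1" "- (\<Sum>k\<le>n. q k * log 2 (q k)) = b"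
      using eventually_happens'[OF sequentially_bot] by blast
    have "0 < log 2 (real v)" using v(1) by simp
    then have "q 0 * log 2 (real v) = a" using v(2) by simp
    then show ?thesis using v(1) q by (intro exI[of _ v] exI[of _ n] exI[of _ q]) simp
  qed
  then obtain v n :: nat and q :: "nat \<Rightarrow> real" where v: "0 < v" "q 0 * log 2 (real v) = a"
    and q: "\<forall>k\<le>n. 0 < q k" "sum q {..n} = 1" "- (\<Sum>k\<le>n. q k * log 2 (q k)) = b" by blast
  \<comment> \<open>Squares of order 1 contribute log 1 = 0, so only atom 0 affects the coefficient
    \<open>a\<close>.\<close>
  define w where "w k = (if k = 0 then v else 1)" for k :: nat
  have "(\<Sum>k\<le>n. q k * log 2 (real (w k))) = (\<Sum>k\<in>{0}. q k * log 2 (real (w k)))"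
    by (rule sum.mono_neutral_right) (auto simp: w_def)
  then have "(\<Sum>k\<le>n. q k * log 2 (real (w k))) = a" using v(2) by (simp add: w_def)
  moreover have "entropic (face_point U23_123 U14
    (\<Sum>k\<le>n. q k * log 2 (real (w k))) (- (\<Sum>k\<le>n. q k * log 2 (q k))))"
    using q v by (intro entropic_mixture) (auto simp: w_def)
  ultimately show ?thesis using q(3) by simp
qed

theorem mainTheorem11:
  fixes a b :: real and h :: "real ^ (4 set)"
  assumes "a \<ge> 0" and "b \<ge> 0"
    and "h \<in> spanned_face U23_123 U14"
    and "h = face_point U23_123 U14 a b"
  shows "entropic h \<longleftrightarrow>
    (a \<ge> 0 \<and> b > 0) \<or> (\<exists>v::nat. v > 0 \<and> a = log 2 (real v) \<and> b = 0)"
proof (cases "b = 0")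
  case True
  \<comment> \<open>A single square of order \<open>v\<close> with weight 1: its index has zero
    entropy.\<close>
  have "entropic h" if "0 < v" "a = log 2 (real v)" for v :: nat
    using entropic_mixture[of "{0}" "\<lambda>_. 1" "\<lambda>_. v"] that True assms(4) by simp
  then show ?thesis
    using entropic_face_point_boundary[of a] True assms(4) by auto
next
  case False
  then show ?thesis using entropic_face_point_interior[of a b] assms by auto
qed

end
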